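(* Let $\alpha\ge\beta\ge-1/2$ with $\alpha>-1/2$, let $\rho:=\alpha+\beta+1$, and let $T>0$ be a constant. There exists a constant $C=C(\alpha,\beta,T)$ such that for all $\lambda\in\mathbb R$, $t\in[0,T]$, and $n\ge1$, $$\bigl|\varphi_{i\rho-n\lambda}^{(\alpha,\beta)}(t/n)-j_\alpha(\lambda t)\bigr|\le C\,|\lambda|\,t^2/n.$$
   Context: The Jacobi functions are $$\varphi_\mu^{(\alpha,\beta)}(t):={}_2F_1\bigl((\alpha+\beta+1-i\mu)/2,(\alpha+\beta+1+i\mu)/2;\alpha+1;-\sinh^2t\bigr)\qquad(\mu\in\mathbb C,\ t\ge0),$$ where ${}_2F_1$ is the Gauss hypergeometric function (analytically continued to $\mathbb C\setminus[1,\infty[$). The normalized Bessel functions are $$j_\alpha(t):=\Gamma(\alpha+1)\sum_{l=0}^\infty\frac{(-1)^l(t/2)^{2l}}{l!\,\Gamma(l+\alpha+1)}.$$ *)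

theory Defs
  imports "HOL-Complex_Analysis.Complex_Analysis"
begin

text \<open>The cut plane \<open>\<complex> \<setminus> [1,\<infinity>[\<close>.\<close>

definition cut_plane :: "complex set" where
  "cut_plane = - (complex_of_real ` {1..})"

text \<open>
  The Gauss hypergeometric series
  \<open>\<Sum>n. (a)\<^sub>n (b)\<^sub>n / ((c)\<^sub>n n!) z\<^sup>n\<close> on the unit disc, continued analytically to the cut plane.
  The parameter \<open>c\<close> must not be a nonpositive integer. The continuation exists classically, and
  \<open>hyp2F1_eqI\<close> shows that the choice made here is irrelevant on the cut plane; on the cut
  itself the value is unspecified.
\<close>

definition is_hyp2F1 :: "complex \<Rightarrow> complex \<Rightarrow> complex \<Rightarrow> (complex \<Rightarrow> complex) \<Rightarrow> bool" where
  "is_hyp2F1 a b c f \<longleftrightarrow>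
     f holomorphic_on cut_plane \<and>
     (\<forall>z. norm z < 1 \<longrightarrow> f z = eval_fps (fps_hypergeo [a, b] [c] 1) z)"

definition hyp2F1 :: "complex \<Rightarrow> complex \<Rightarrow> complex \<Rightarrow> complex \<Rightarrow> complex" where
  "hyp2F1 a b c = (SOME f. is_hyp2F1 a b c f)"

lemma is_hyp2F1_unique:
  assumes f: "is_hyp2F1 a b c f" and g: "is_hyp2F1 a b c g" and z: "z \<in> cut_plane"
  shows "f z = g z"
proof -
  have "closed (complex_of_real ` {1..})"
    by (intro closed_injective_linear_image) (auto simp: inj_on_def linear_iff scaleR_conv_of_real)
  then have op: "open cut_plane"
    by (auto simp: cut_plane_def)
  have conn: "connected cut_plane"
    unfolding cut_plane_def
    by (intro starlike_imp_connected starlike_slotted_complex_plane_right)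
  have sub: "ball 0 1 \<subseteq> cut_plane"
    by (auto simp: cut_plane_def)
  have "f z - g z = 0"
  proof (rule analytic_continuation[of "\<lambda>z. f z - g z" cut_plane "ball 0 1" 0 z])
    show "(\<lambda>z. f z - g z) holomorphic_on cut_plane"
      using f g by (intro holomorphic_intros) (auto simp: is_hyp2F1_def)
    show "(0::complex) islimpt ball 0 1"
      by (simp add: islimpt_ball)
    show "0 \<in> cut_plane"
      using sub by auto
    show "f w - g w = 0" if "w \<in> ball 0 1" for w
      using f g that by (auto simp: is_hyp2F1_def)
  qed (use op conn sub z in auto)
  then show ?thesis by simp
qed

lemma hyp2F1_eqI:
  assumes "is_hyp2F1 a b c f" "z \<in> cut_plane"
  shows "hyp2F1 a b c z = f z"
proof -
  have "is_hyp2F1 a b c (hyp2F1 a b c)"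
    unfolding hyp2F1_def using someI[of "is_hyp2F1 a b c", OF assms(1)] by simp
  then show ?thesis
    using assms by (rule is_hyp2F1_unique)
qed

definition jacobi_fun :: "real \<Rightarrow> real \<Rightarrow> complex \<Rightarrow> real \<Rightarrow> complex" where
  "jacobi_fun \<alpha> \<beta> \<mu> t =
     hyp2F1 ((of_real (\<alpha> + \<beta> + 1) - \<i> * \<mu>) / 2) ((of_real (\<alpha> + \<beta> + 1) + \<i> * \<mu>) / 2)
       (of_real (\<alpha> + 1)) (of_real (- (sinh t)\<^sup>2))"

definition norm_bessel :: "real \<Rightarrow> real \<Rightarrow> real" where
  "norm_bessel \<alpha> t =
     Gamma (\<alpha> + 1) * (\<Sum>l. (- 1) ^ l * (t / 2) ^ (2 * l) / (fact l * Gamma (real l + \<alpha> + 1)))"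

end

theory Submission
  imports Defs
begin

text \<open>
  Both functions solve nearly the same second order equation, and the estimate is an energy
  estimate for their difference. For \<open>\<mu> = i\<rho> - n\<lambda>\<close> one has
  \<open>\<mu>\<^sup>2 + \<rho>\<^sup>2 = n\<^sup>2\<lambda>\<^sup>2 - 2i\<rho>n\<lambda>\<close>. Hence \<open>v(t) = \<phi>\<^sub>\<mu>(t/n)\<close> and \<open>w(t) = j\<^sub>\<alpha>(\<lambda>t)\<close> satisfy, for \<open>t > 0\<close>,

    \<open>v'' + A v' + \<lambda>\<^sup>2 v = (2i\<rho>\<lambda>/n) v\<close>  and  \<open>w'' + A\<^sub>0 w' + \<lambda>\<^sup>2 w = 0\<close>,

  where \<open>A(t) = ((2\<alpha>+1) coth(t/n) + (2\<beta>+1) tanh(t/n)) / n\<close> and \<open>A\<^sub>0(t) = (2\<alpha>+1) / t\<close>, with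
  \<open>v(0) = w(0) = 1\<close> and \<open>v'(0) = w'(0) = 0\<close>. Both damping coefficients are nonnegative, and
  \<open>0 \<le> A - A\<^sub>0 \<le> 2\<rho>/n\<close> because \<open>1/x \<le> coth x \<le> 1/x + 1\<close>.

  For a damped oscillator \<open>y'' + A y' + \<lambda>\<^sup>2 y = g\<close> with \<open>A \<ge> 0\<close>, the energy
  \<open>|y'|\<^sup>2 + \<lambda>\<^sup>2|y|\<^sup>2\<close> grows only through the forcing \<open>g\<close>, whatever the singularity of \<open>A\<close> at 0
  (lemma \<open>damped_oscillator_energy\<close>). Applied to \<open>v\<close> it bounds \<open>|v'|\<close> and \<open>|\<lambda>||v|\<close> by a constant
  multiple of \<open>|\<lambda>|\<close>, uniformly in \<open>\<lambda>\<close> and \<open>n\<close>. Applied to \<open>v - w\<close>, whose forcing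
  \<open>(2i\<rho>\<lambda>/n) v - (A - A\<^sub>0) v'\<close> is then at most a constant times \<open>|\<lambda>|/n\<close>, it gives
  \<open>|v' - w'| = O(|\<lambda>| t / n)\<close>, and one integration gives the theorem.

  It remains to know that \<open>\<phi>\<^sub>\<mu>\<close> solves its equation for every \<open>t\<close>, also where \<open>sinh t \<ge> 1\<close> and
  the hypergeometric series diverges. For this the continuation of the hypergeometric
  function is constructed (lemma \<open>hyp2F1_ode\<close>). The map
  \<open>w = (1 - sqrt(1-z)) / (1 + sqrt(1-z))\<close> sends the cut plane into the unit disc; in the variable \<open>w\<close>
  the only singularity of the hypergeometric equation in the open disc is a regular singular point at
  \<open>w = 0\<close>. So the power series solution at \<open>0\<close> converges in the whole disc (Frobenius), and pulling
  it back to the cut plane gives a holomorphic solution of the hypergeometric equation with value 1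
  at 0. Its Taylor coefficients satisfy the recurrence of the hypergeometric series, so it is the
  continuation of that series.
\<close>

text \<open>The infix \<open>$\<close> is kept for coefficients of power series, not for components of vectors.\<close>

unbundle no vec_syntax

section \<open>The Frobenius method at a regular singular point\<close>

lemma frobenius_nth:
  fixes p q u :: "complex fps"
  shows "(fps_X * fps_deriv (fps_deriv u) + p * fps_deriv u + q * u) $ n =
         of_nat (Suc n) * (of_nat n + p $ 0) * u $ Suc n +
         (\<Sum>k\<le>n. (of_nat k * p $ (Suc n - k) + q $ (n - k)) * u $ k)"
proof -
  have 1: "(fps_X * fps_deriv (fps_deriv u)) $ n = of_nat (Suc n) * of_nat n * u $ Suc n"
    by (cases n) (auto simp: algebra_simps)
  have "(p * fps_deriv u) $ n = (\<Sum>i\<in>{..n}. p $ (n - i) * (of_nat (Suc i) * u $ Suc i))"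
    unfolding mult.commute[of p] by (simp only: fps_mult_nth atLeast0AtMost fps_deriv_nth) (simp add: mult_ac)
  also have "\<dots> = (\<Sum>k\<in>{..Suc n}. p $ (Suc n - k) * (of_nat k * u $ k))"
    by (subst sum.atMost_Suc_shift) simp
  finally have 2: "(p * fps_deriv u) $ n = \<dots>" .
  have 3: "(q * u) $ n = (\<Sum>i\<in>{..n}. q $ (n - i) * u $ i)"
    unfolding mult.commute[of q] by (simp only: fps_mult_nth atLeast0AtMost fps_deriv_nth) (simp add: mult_ac)
  show ?thesis
    by (simp add: 1 2 3) (simp add: algebra_simps sum.distrib)
qed

text \<open>
  The coefficient formula above determines \<open>u $ Suc n\<close> from the earlier coefficients as long as its
  leading factor does not vanish; the second exponent \<open>1 - p $ 0\<close> at the singular point is then not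
  a positive integer.
\<close>

lemma frobenius_exists:
  fixes p q :: "complex fps"
  assumes c: "\<And>n. of_nat n + p $ 0 \<noteq> 0"
  shows "\<exists>u. u $ 0 = 1 \<and> fps_X * fps_deriv (fps_deriv u) + p * fps_deriv u + q * u = 0"
proof -
  define step :: "(nat \<Rightarrow> complex) \<Rightarrow> nat \<Rightarrow> complex" where
    "step v n = (case n of 0 \<Rightarrow> 1 | Suc m \<Rightarrow>
        - (\<Sum>k\<le>m. (of_nat k * p $ (Suc m - k) + q $ (m - k)) * v k) / (of_nat (Suc m) * (of_nat m + p $ 0)))" for v n
  define u where "u = Abs_fps (wfrec less_than step)"
  have "adm_wf less_than step"
    by (auto simp: adm_wf_def step_def split: nat.splits intro!: sum.cong)
  from wfrec_fixpoint[OF wf_less_than this] have u: "u $ n = step (fps_nth u) n" for n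
    by (metis u_def fps_nth_Abs_fps ext)
  have "of_nat (Suc n) * (of_nat n + p $ 0) * u $ Suc n =
         - (\<Sum>k\<le>n. (of_nat k * p $ (Suc n - k) + q $ (n - k)) * u $ k)" for n
    using c[of n] by (subst u) (simp add: step_def del: of_nat_Suc)
  then have "fps_X * fps_deriv (fps_deriv u) + p * fps_deriv u + q * u = 0"
    by (intro fps_ext) (simp only: frobenius_nth fps_zero_nth add.left_inverse)
  moreover have "u $ 0 = 1" by (subst u) (simp add: step_def)
  ultimately show ?thesis by blast
qed

lemma conv_radius_ge_of_bounded:
  fixes f :: "nat \<Rightarrow> complex"
  assumes "\<And>r. 0 < r \<Longrightarrow> ereal r < R \<Longrightarrow> \<exists>B. \<forall>n. norm (f n) * r ^ n \<le> B"
  shows "conv_radius f \<ge> R"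
proof (rule conv_radius_geI_ex')
  fix r :: real assume r: "0 < r" "ereal r < R"
  obtain r' where r': "ereal r < ereal r'" "ereal r' < R"
    using ereal_dense2[OF r(2)] by blast
  with assms[of r'] r obtain B where "\<And>n. norm (f n) * r' ^ n \<le> B" by auto
  then have "summable (\<lambda>n. norm (f n) * r ^ n)"
    using r r' by (intro Abel_lemma[of r r']) auto
  then show "summable (\<lambda>n. f n * of_real r ^ n)"
    using r by (intro summable_norm_cancel[of "\<lambda>n. f n * of_real r ^ n"])
      (simp add: norm_mult norm_power)
qed

text \<open>
  For \<open>r < R\<close> the numbers \<open>|u\<^sub>n| r\<^sup>n\<close> are bounded. The recurrence bounds the one with index \<open>n + 1\<close> by the
  maximum \<open>B\<close> of its predecessors, times \<open>M / |n + p\<^sub>0|\<close> with \<open>M = \<Sum>|p\<^sub>j| r\<^sup>j + r \<Sum>|q\<^sub>j| r\<^sup>j\<close>: the factor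
  \<open>n + 1\<close> on its left side absorbs the index that multiplies \<open>p\<close> on the right. As soon as
  \<open>n \<ge> M + |p\<^sub>0|\<close> the maximum therefore no longer increases.
\<close>

lemma frobenius_conv_radius:
  fixes p q u :: "complex fps"
  assumes ode: "fps_X * fps_deriv (fps_deriv u) + p * fps_deriv u + q * u = 0"
    and p: "R \<le> fps_conv_radius p" and q: "R \<le> fps_conv_radius q"
  shows "R \<le> fps_conv_radius u"
  unfolding fps_conv_radius_def
proof (rule conv_radius_ge_of_bounded)
  fix r :: real assume r: "0 < r" "ereal r < R"
  define M where "M = (\<Sum>j. norm (p $ j) * r ^ j) + r * (\<Sum>j. norm (q $ j) * r ^ j)"
  have sp: "summable (\<lambda>j. norm (p $ j) * r ^ j)"
    using norm_summable_fps[of "of_real r" p] r p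
    by (auto simp: norm_mult norm_power intro: less_le_trans)
  have sq: "summable (\<lambda>j. norm (q $ j) * r ^ j)"
    using norm_summable_fps[of "of_real r" q] r q
    by (auto simp: norm_mult norm_power intro: less_le_trans)
  \<comment> \<open>The summand 1 keeps n + p $ 0 away from 0 beyond N even if M = 0.\<close>
  define N where "N = nat \<lceil>M + norm (p $ 0) + 1\<rceil>"
  define B where "B = Max ((\<lambda>k. norm (u $ k) * r ^ k) ` {..N})"
  have "norm (u $ n) * r ^ n \<le> B" for n
  proof (induction n rule: less_induct)
    case (less m)
    show ?case
    proof (cases "m \<le> N")
      case True
      then show ?thesis unfolding B_def by (intro Max_ge) auto
    next
      case False
      then obtain n where m: "m = Suc n" and n: "N \<le> n" by (cases m) auto
      have B0: "0 \<le> B" using less(1)[of 0] m by (auto intro: order_trans[rotated])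
      have "M + norm (p $ 0) + 1 \<le> real n"
        using n unfolding N_def by linarith
      moreover have "real n - norm (p $ 0) \<le> norm (of_nat n + p $ 0)"
        using norm_triangle_ineq2[of "of_nat n" "- p $ 0"] by simp
      ultimately have Mn: "M + 1 \<le> norm (of_nat n + p $ 0)" by linarith
      have Mpos: "0 \<le> M"
        unfolding M_def using r sp sq by (intro add_nonneg_nonneg mult_nonneg_nonneg suminf_nonneg) auto
      have "(\<Sum>k\<le>n. norm (p $ (Suc n - k)) * r ^ (Suc n - k)) = (\<Sum>j\<in>{1..Suc n}. norm (p $ j) * r ^ j)"
        by (rule sum.reindex_bij_witness[of _ "\<lambda>j. Suc n - j" "\<lambda>k. Suc n - k"]) auto
      also have "\<dots> \<le> (\<Sum>j. norm (p $ j) * r ^ j)"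
        using r by (intro sum_le_suminf sp) auto
      finally have P: "(\<Sum>k\<le>n. norm (p $ (Suc n - k)) * r ^ (Suc n - k)) \<le> (\<Sum>j. norm (p $ j) * r ^ j)" .
      have "(\<Sum>k\<le>n. norm (q $ (n - k)) * r ^ (n - k)) = (\<Sum>j\<in>{..n}. norm (q $ j) * r ^ j)"
        by (rule sum.reindex_bij_witness[of _ "\<lambda>j. n - j" "\<lambda>k. n - k"]) auto
      also have "\<dots> \<le> (\<Sum>j. norm (q $ j) * r ^ j)"
        using r by (intro sum_le_suminf sq) auto
      finally have Q: "(\<Sum>k\<le>n. norm (q $ (n - k)) * r ^ (n - k)) \<le> (\<Sum>j. norm (q $ j) * r ^ j)" .
      have coeff: "of_nat (Suc n) * (of_nat n + p $ 0) * u $ Suc n =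
          - (\<Sum>k\<le>n. (of_nat k * p $ (Suc n - k) + q $ (n - k)) * u $ k)"
        using frobenius_nth[of u p q n] ode by (simp add: eq_neg_iff_add_eq_0)
      have "real (Suc n) * norm (of_nat n + p $ 0) * (norm (u $ Suc n) * r ^ Suc n) =
         norm (\<Sum>k\<le>n. (of_nat k * p $ (Suc n - k) + q $ (n - k)) * u $ k) * r ^ Suc n"
        using arg_cong[OF coeff, of norm] by (simp add: norm_mult del: of_nat_Suc)
      also have "\<dots> \<le> (\<Sum>k\<le>n. norm ((of_nat k * p $ (Suc n - k) + q $ (n - k)) * u $ k)) * r ^ Suc n"
        using r by (intro mult_right_mono norm_sum) auto
      also have "\<dots> = (\<Sum>k\<le>n. norm (of_nat k * p $ (Suc n - k) + q $ (n - k)) * r ^ (Suc n - k) * (norm (u $ k) * r ^ k))"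
        unfolding sum_distrib_right
      proof (rule sum.cong[OF refl])
        fix k assume "k \<in> {..n}"
        then have "r ^ Suc n = r ^ (Suc n - k) * r ^ k" by (simp flip: power_add del: power_Suc)
        then show "norm ((of_nat k * p $ (Suc n - k) + q $ (n - k)) * u $ k) * r ^ Suc n =
            norm (of_nat k * p $ (Suc n - k) + q $ (n - k)) * r ^ (Suc n - k) * (norm (u $ k) * r ^ k)"
          by (simp add: norm_mult)
      qed
      also have "\<dots> \<le> (\<Sum>k\<le>n. (real (Suc n) * (norm (p $ (Suc n - k)) + norm (q $ (n - k))) * r ^ (Suc n - k)) * B)"
      proof (intro sum_mono mult_mono mult_right_mono)
        fix k assume k: "k \<in> {..n}"
        have "norm (of_nat k * p $ (Suc n - k) + q $ (n - k)) \<le> real k * norm (p $ (Suc n - k)) + 1 * norm (q $ (n - k))"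
          by (rule order_trans[OF norm_triangle_ineq]) (simp add: norm_mult)
        also have "\<dots> \<le> real (Suc n) * norm (p $ (Suc n - k)) + real (Suc n) * norm (q $ (n - k))"
          using k by (intro add_mono mult_right_mono) auto
        finally show "norm (of_nat k * p $ (Suc n - k) + q $ (n - k)) \<le> real (Suc n) * (norm (p $ (Suc n - k)) + norm (q $ (n - k)))"
          by (simp add: algebra_simps)
        show "norm (u $ k) * r ^ k \<le> B" using less(1)[of k] k m by auto
      qed (use r in auto)
      also have "\<dots> = real (Suc n) * B * ((\<Sum>k\<le>n. norm (p $ (Suc n - k)) * r ^ (Suc n - k)) + r * (\<Sum>k\<le>n. norm (q $ (n - k)) * r ^ (n - k)))"
        unfolding sum_distrib_left sum.distrib[symmetric]
        by (rule sum.cong[OF refl]) (simp add: algebra_simps Suc_diff_le)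
      also have "\<dots> \<le> real (Suc n) * B * M"
        unfolding M_def using B0 r P Q by (intro mult_left_mono add_mono) auto
      finally have "norm (of_nat n + p $ 0) * (norm (u $ Suc n) * r ^ Suc n) \<le> M * B"
        by (simp del: of_nat_Suc add: mult_ac)
      also have "\<dots> \<le> norm (of_nat n + p $ 0) * B"
        using Mn B0 by (intro mult_right_mono) auto
      finally have "norm (u $ Suc n) * r ^ Suc n \<le> B"
        using Mn Mpos by (subst (asm) mult_le_cancel_left_pos) auto
      then show ?thesis using m by simp
    qed
  qed
  then show "\<exists>B. \<forall>n. norm (u $ n) * r ^ n \<le> B" by blast
qed

lemma frobenius_eval:
  fixes p q u :: "complex fps"
  assumes ode: "fps_X * fps_deriv (fps_deriv u) + p * fps_deriv u + q * u = 0"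
    and p: "R \<le> fps_conv_radius p" and q: "R \<le> fps_conv_radius q"
    and w: "ereal (norm w) < R"
  shows "(eval_fps u has_field_derivative eval_fps (fps_deriv u) w) (at w)"
    and "(eval_fps (fps_deriv u) has_field_derivative eval_fps (fps_deriv (fps_deriv u)) w) (at w)"
    and "w * eval_fps (fps_deriv (fps_deriv u)) w + eval_fps p w * eval_fps (fps_deriv u) w
           + eval_fps q w * eval_fps u w = 0"
proof -
  have "ereal (norm w) < fps_conv_radius u"
    using frobenius_conv_radius[OF ode p q] w by simp
  moreover from this have "ereal (norm w) < fps_conv_radius (fps_deriv u)"
    using fps_conv_radius_deriv less_le_trans by blast
  moreover from this have "ereal (norm w) < fps_conv_radius (fps_deriv (fps_deriv u))"
    using fps_conv_radius_deriv less_le_trans by blast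
  moreover have "ereal (norm w) < fps_conv_radius p" "ereal (norm w) < fps_conv_radius q"
    using p q w by simp_all
  ultimately have rad: "ereal (norm w) < fps_conv_radius u" "ereal (norm w) < fps_conv_radius (fps_deriv u)"
    "ereal (norm w) < fps_conv_radius (fps_deriv (fps_deriv u))"
    "ereal (norm w) < fps_conv_radius p" "ereal (norm w) < fps_conv_radius q"
    by blast+
  show "(eval_fps u has_field_derivative eval_fps (fps_deriv u) w) (at w)"
    "(eval_fps (fps_deriv u) has_field_derivative eval_fps (fps_deriv (fps_deriv u)) w) (at w)"
    using rad by (auto intro!: has_field_derivative_eval_fps)
  have rad_mult: "ereal (norm w) < fps_conv_radius (F * G)"
    if "ereal (norm w) < fps_conv_radius F" "ereal (norm w) < fps_conv_radius G" for F G :: "complex fps"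
    using that fps_conv_radius_mult[of F G] by (meson less_le_trans min_less_iff_conj)
  have rad_add: "ereal (norm w) < fps_conv_radius (F + G)"
    if "ereal (norm w) < fps_conv_radius F" "ereal (norm w) < fps_conv_radius G" for F G :: "complex fps"
    using that fps_conv_radius_add[of F G] by (meson less_le_trans min_less_iff_conj)
  have "0 = eval_fps (fps_X * fps_deriv (fps_deriv u) + p * fps_deriv u + q * u) w"
    by (simp add: ode)
  also have "\<dots> = w * eval_fps (fps_deriv (fps_deriv u)) w + eval_fps p w * eval_fps (fps_deriv u) w
      + eval_fps q w * eval_fps u w"
    using rad by (simp add: eval_fps_add eval_fps_mult rad_mult rad_add)
  finally show "w * eval_fps (fps_deriv (fps_deriv u)) w + eval_fps p w * eval_fps (fps_deriv u) w
      + eval_fps q w * eval_fps u w = 0" by simp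
qed

lemma frobenius_holomorphic:
  fixes p q :: "complex \<Rightarrow> complex"
  assumes p: "p holomorphic_on ball 0 1" and q: "q holomorphic_on ball 0 1"
    and c: "\<And>n. of_nat n + p 0 \<noteq> 0"
  obtains u u' u'' where "u 0 = 1"
    "\<And>w. norm w < 1 \<Longrightarrow> (u has_field_derivative u' w) (at w)"
    "\<And>w. norm w < 1 \<Longrightarrow> (u' has_field_derivative u'' w) (at w)"
    "\<And>w. norm w < 1 \<Longrightarrow> w * u'' w + p w * u' w + q w * u w = 0"
proof -
  define P where "P = fps_expansion p 0"
  define Q where "Q = fps_expansion q 0"
  have eb: "eball (0::complex) 1 = ball 0 1"
    by (auto simp: eball_def)
  have P: "1 \<le> fps_conv_radius P" "norm w < 1 \<Longrightarrow> eval_fps P w = p w" for w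
    using conv_radius_fps_expansion[of p 0 1] eval_fps_expansion'[of p 0 1 w] p
    by (auto simp: eb P_def)
  have Q: "1 \<le> fps_conv_radius Q" "norm w < 1 \<Longrightarrow> eval_fps Q w = q w" for w
    using conv_radius_fps_expansion[of q 0 1] eval_fps_expansion'[of q 0 1 w] q
    by (auto simp: eb Q_def)
  have "P $ 0 = p 0" by (simp add: P_def fps_expansion_def)
  then obtain U where U0: "U $ 0 = 1" and U: "fps_X * fps_deriv (fps_deriv U) + P * fps_deriv U + Q * U = 0"
    using frobenius_exists[of P Q] c by auto
  show ?thesis
  proof (rule that)
    show "eval_fps U 0 = 1" using U0 by (simp add: eval_fps_at_0)
  qed (use frobenius_eval[OF U P(1) Q(1)] P(2) Q(2) in auto)
qed


section \<open>Continuation of the hypergeometric function to the cut plane\<close>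

lemma open_cut_plane: "open cut_plane"
proof -
  have "closed (complex_of_real ` {1..})"
    by (intro closed_injective_linear_image) (auto simp: inj_on_def linear_iff scaleR_conv_of_real)
  then show ?thesis by (auto simp: cut_plane_def)
qed

text \<open>
  The principal square root of \<open>1 - z\<close> takes the cut plane to the right half plane, which the
  transformation \<open>r \<mapsto> (1 - r) / (1 + r)\<close> takes to the unit disc.
\<close>

lemma csqrt_cut_plane:
  assumes "z \<in> cut_plane"
  shows "Re (csqrt (1 - z)) > 0"
    and "((\<lambda>z. csqrt (1 - z)) has_field_derivative - 1 / (2 * csqrt (1 - z))) (at z)"
proof -
  have "1 - z \<notin> \<real>\<^sub>\<le>\<^sub>0"
  proof
    assume "1 - z \<in> \<real>\<^sub>\<le>\<^sub>0"
    then obtain x where "x \<le> 0" "1 - z = of_real x" by (auto elim!: nonpos_Reals_cases)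
    then have "z = of_real (1 - x)" "1 - x \<in> {1..}" by (auto simp: algebra_simps)
    then show False using assms unfolding cut_plane_def by blast
  qed
  then show "((\<lambda>z. csqrt (1 - z)) has_field_derivative - 1 / (2 * csqrt (1 - z))) (at z)"
    by (auto intro!: derivative_eq_intros has_field_derivative_csqrt')
  show "Re (csqrt (1 - z)) > 0"
  proof (rule ccontr)
    assume "\<not> Re (csqrt (1 - z)) > 0"
    then have "Re (csqrt (1 - z)) = 0" using csqrt_principal[of "1 - z"] by simp
    then have "csqrt (1 - z) = \<i> * of_real (Im (csqrt (1 - z)))" by (simp add: complex_eq_iff)
    then have "1 - z = of_real (- (Im (csqrt (1 - z)))\<^sup>2)"
      by (metis power2_csqrt power_mult_distrib power2_i mult_minus1 of_real_minus of_real_power)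
    then have "1 - z \<in> \<real>\<^sub>\<le>\<^sub>0" by (metis nonpos_Reals_of_real_iff neg_le_0_iff_le zero_le_power2)
    then show False using \<open>1 - z \<notin> \<real>\<^sub>\<le>\<^sub>0\<close> by contradiction
  qed
qed

text \<open>
  Comparing coefficients in the differential equation gives the two-term recurrence of the
  hypergeometric series, which with the initial value determines all Taylor coefficients at 0.
\<close>

lemma is_hyp2F1_of_ode:
  assumes c: "\<And>n. of_nat n + c \<noteq> 0"
    and hol: "f holomorphic_on cut_plane" and f0: "f 0 = 1"
    and ode: "\<And>z. norm z < 1 \<Longrightarrow>
      z * (1 - z) * deriv (deriv f) z + (c - (a + b + 1) * z) * deriv f z - a * b * f z = 0"
  shows "is_hyp2F1 a b c f"
proof -
  have sub: "ball 0 1 \<subseteq> cut_plane" by (auto simp: cut_plane_def)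
  define F where "F = fps_expansion f 0"
  have hol1: "f holomorphic_on ball 0 1" using hol sub by (rule holomorphic_on_subset)
  then have F: "f has_fps_expansion F"
    unfolding F_def by (intro analytic_at_imp_has_fps_expansion_0) (auto simp: analytic_at intro!: exI[of _ "ball 0 1"])
  have "(\<lambda>z. z * (1 - z) * deriv (deriv f) z + (c - (a + b + 1) * z) * deriv f z - a * b * f z)
     has_fps_expansion (fps_X * (1 - fps_X) * fps_deriv (fps_deriv F)
       + (fps_const c - fps_const (a + b + 1) * fps_X) * fps_deriv F - fps_const (a * b) * F)"
    by (intro fps_expansion_intros F)
  moreover have "\<forall>\<^sub>F z in nhds 0. z * (1 - z) * deriv (deriv f) z + (c - (a + b + 1) * z) * deriv f z - a * b * f z = 0"
  proof (rule eventually_mono[OF eventually_nhds_in_open[of "ball 0 1" "0::complex"]])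
    fix z :: complex assume "z \<in> ball 0 1"
    then show "z * (1 - z) * deriv (deriv f) z + (c - (a + b + 1) * z) * deriv f z - a * b * f z = 0"
      by (intro ode) simp
  qed auto
  ultimately have "(\<lambda>z. 0) has_fps_expansion (fps_X * (1 - fps_X) * fps_deriv (fps_deriv F)
       + (fps_const c - fps_const (a + b + 1) * fps_X) * fps_deriv F - fps_const (a * b) * F)"
    by (subst has_fps_expansion_cong[OF _ refl, symmetric]) auto
  then have eq: "fps_X * (1 - fps_X) * fps_deriv (fps_deriv F)
       + (fps_const c - fps_const (a + b + 1) * fps_X) * fps_deriv F - fps_const (a * b) * F = 0"
    using fps_expansion_unique_complex has_fps_expansion_0 by blast
  have rec: "of_nat (Suc n) * (c + of_nat n) * F $ Suc n = (a + of_nat n) * (b + of_nat n) * F $ n" for n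
  proof -
    have "(fps_X * fps_deriv (fps_deriv F)
       + fps_const c * fps_deriv F - fps_X * (fps_X * fps_deriv (fps_deriv F)) -
         fps_const (a + b + 1) * (fps_X * fps_deriv F) - fps_const (a * b) * F) $ n = 0"
      using arg_cong[OF eq, of "\<lambda>F. F $ n"] by (simp add: algebra_simps)
    note 0 = this
    show ?thesis
    proof (cases n)
      case (Suc m)
      with 0 show ?thesis by (cases m) (auto simp: algebra_simps)
    qed (use 0 in \<open>auto simp: algebra_simps\<close>)
  qed
  have "F $ n = fps_hypergeo [a, b] [c] 1 $ n" for n
  proof (induction n)
    case 0
    show ?case using f0 by (simp add: F_def fps_expansion_def)
  next
    case (Suc n)
    have "c + of_nat n \<noteq> 0" using c[of n] by (simp add: add.commute)
    then have "F $ Suc n = (a + of_nat n) * (b + of_nat n) / (of_nat (Suc n) * (c + of_nat n)) * F $ n"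
      using rec[of n] by (subst times_divide_eq_left, subst eq_divide_eq) (simp add: mult_ac del: of_nat_Suc)
    then show ?case
      by (simp add: fps_hypergeo_rec Suc.IH del: of_nat_Suc fps_hypergeo_nth)
  qed
  then have "F = fps_hypergeo [a, b] [c] 1" by (rule fps_ext)
  moreover have "f z = eval_fps F z" if "norm z < 1" for z
    using eval_fps_expansion'[of f 0 1 z] hol1 that by (auto simp: F_def eball_def ball_def)
  ultimately show ?thesis unfolding is_hyp2F1_def using hol by simp
qed

text \<open>
  The solution is \<open>u(w)\<close> with \<open>w = (1 - s) / (1 + s)\<close>, \<open>s = sqrt(1 - z)\<close>, where \<open>u\<close> comes from the Frobenius
  method on the disc. The map \<open>s \<mapsto> (1 - s) / (1 + s)\<close> is an involution, so \<open>s = (1 - w) / (1 + w)\<close>; this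
  expression is \<open>r w\<close> in the proof, and it makes the coefficients of the equation for \<open>u\<close> short.
\<close>

lemma hyp2F1_ode:
  fixes a b c :: complex
  assumes c: "\<And>n. of_nat n + c \<noteq> 0"
  obtains f f' f'' where "is_hyp2F1 a b c f"
    "\<And>z. z \<in> cut_plane \<Longrightarrow> (f has_field_derivative f' z) (at z)"
    "\<And>z. z \<in> cut_plane \<Longrightarrow> (f' has_field_derivative f'' z) (at z)"
    "\<And>z. z \<in> cut_plane \<Longrightarrow>
      z * (1 - z) * f'' z + (c - (a + b + 1) * z) * f' z - a * b * f z = 0"
    "f 0 = 1"
proof -
  define r where "r w = (1 - w) / (1 + w)" for w :: complex
  define p where "p w = ((1 - r w) * (1 + 3 * r w) / 2 + c - (a + b + 1) * (1 - (r w)\<^sup>2)) / r w" for w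
  define q where "q w = - a * b * (1 + r w)\<^sup>2" for w
  have ne: "1 + w \<noteq> 0" "1 - w \<noteq> 0" if "norm w < 1" for w :: complex
    using that by (auto simp: add_eq_0_iff)
  have r: "r holomorphic_on ball 0 1" "\<And>w. w \<in> ball 0 1 \<Longrightarrow> r w \<noteq> 0"
    unfolding r_def using ne by (auto intro!: holomorphic_intros)
  have "p holomorphic_on ball 0 1" "q holomorphic_on ball 0 1"
    unfolding p_def q_def using r by (auto intro!: holomorphic_intros)
  moreover have "p 0 = c" by (simp add: p_def r_def)
  ultimately obtain u u' u'' where u: "u 0 = 1"
    "\<And>w. norm w < 1 \<Longrightarrow> (u has_field_derivative u' w) (at w)"
    "\<And>w. norm w < 1 \<Longrightarrow> (u' has_field_derivative u'' w) (at w)"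
    "\<And>w. norm w < 1 \<Longrightarrow> w * u'' w + p w * u' w + q w * u w = 0"
    using frobenius_holomorphic[of p q] c by metis
  define s where "s z = csqrt (1 - z)" for z
  define W where "W z = r (s z)" for z
  define f where "f z = u (W z)" for z
  define f' where "f' z = u' (W z) * (1 / (s z * (1 + s z)\<^sup>2))" for z
  define f'' where "f'' z = u'' (W z) * (1 / (s z * (1 + s z)\<^sup>2))\<^sup>2 +
      u' (W z) * ((1 + 3 * s z) / (2 * s z ^ 3 * (1 + s z) ^ 3))" for z
  have s: "s z \<noteq> 0" "1 + s z \<noteq> 0" "(s has_field_derivative - 1 / (2 * s z)) (at z)"
    "1 - (s z)\<^sup>2 = z" "norm (W z) < 1" "r (W z) = s z"
    "(W has_field_derivative 1 / (s z * (1 + s z)\<^sup>2)) (at z)"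
    "((\<lambda>z. 1 / (s z * (1 + s z)\<^sup>2)) has_field_derivative (1 + 3 * s z) / (2 * s z ^ 3 * (1 + s z) ^ 3)) (at z)"
    if "z \<in> cut_plane" for z
  proof -
    have re: "Re (s z) > 0" using csqrt_cut_plane(1)[OF that] by (simp add: s_def)
    show s0: "s z \<noteq> 0" and s1: "1 + s z \<noteq> 0" using re by (auto simp: complex_eq_iff)
    show ds: "(s has_field_derivative - 1 / (2 * s z)) (at z)"
      using csqrt_cut_plane(2)[OF that] by (simp add: s_def[abs_def])
    show "1 - (s z)\<^sup>2 = z" by (simp add: s_def)
    have "norm (1 - s z) < norm (1 + s z)"
      unfolding cmod_def using re by (simp add: power2_eq_square algebra_simps)
    then show "norm (W z) < 1" using s1 by (simp add: W_def r_def norm_divide)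
    have "1 - W z = 2 * s z / (1 + s z)" "1 + W z = 2 / (1 + s z)"
      using s1 by (simp_all add: W_def r_def field_simps)
    then show "r (W z) = s z" using s1 by (simp add: r_def[of "W z"])
    show "(W has_field_derivative 1 / (s z * (1 + s z)\<^sup>2)) (at z)"
      unfolding W_def r_def using s0 s1
      by (auto intro!: derivative_eq_intros ds simp: field_simps power2_eq_square)
    show "((\<lambda>z. 1 / (s z * (1 + s z)\<^sup>2)) has_field_derivative (1 + 3 * s z) / (2 * s z ^ 3 * (1 + s z) ^ 3)) (at z)"
    proof -
      have "((\<lambda>z. s z * (1 + s z)\<^sup>2) has_field_derivative - (1 + 3 * s z) * (1 + s z) / (2 * s z)) (at z)"
      proof -
        have "- (1 / (2 * s z)) * (1 + s z)\<^sup>2 + s z * (2 * (1 + s z) * - (1 / (2 * s z))) =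
            - (1 + 3 * s z) * (1 + s z) / (2 * s z)"
          using s0 by (simp add: divide_simps) (simp add: algebra_simps power2_eq_square)
        then show ?thesis by (auto intro!: derivative_eq_intros ds)
      qed
      from DERIV_inverse_fun[OF this] have "((\<lambda>z. inverse (s z * (1 + s z)\<^sup>2)) has_field_derivative
          - (- (1 + 3 * s z) * (1 + s z) / (2 * s z) * inverse ((s z * (1 + s z)\<^sup>2) ^ Suc (Suc 0)))) (at z)"
        using s0 s1 by simp
      moreover have "- (- k * y / (2 * x) * inverse ((x * y\<^sup>2) ^ Suc (Suc 0))) = k / (2 * x ^ 3 * y ^ 3)"
        if "x \<noteq> 0" "y \<noteq> 0" for x y k :: complex
        using that by (simp add: field_simps power2_eq_square power3_eq_cube)
      ultimately show ?thesis
        using s0 s1 by (simp only: inverse_eq_divide simp_thms)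
    qed
  qed
  have d1: "(f has_field_derivative f' z) (at z)" if "z \<in> cut_plane" for z
    unfolding f_def f'_def by (rule DERIV_chain2[OF u(2)]) (use s(5,7) that in auto)
  have d2: "(f' has_field_derivative f'' z) (at z)" if "z \<in> cut_plane" for z
  proof -
    have "((\<lambda>z. u' (W z)) has_field_derivative u'' (W z) * (1 / (s z * (1 + s z)\<^sup>2))) (at z)"
      by (rule DERIV_chain2[OF u(3)]) (use s(5,7) that in auto)
    from DERIV_mult[OF this s(8)[OF that]] show ?thesis
      unfolding f'_def f''_def by (simp add: power2_eq_square algebra_simps)
  qed
  have ode: "z * (1 - z) * f'' z + (c - (a + b + 1) * z) * f' z - a * b * f z = 0" if z: "z \<in> cut_plane" for z
  proof -
    define S where "S = s z"
    have S: "S \<noteq> 0" "1 + S \<noteq> 0" "z = 1 - S\<^sup>2" "r (W z) = S" "W z = (1 - S) / (1 + S)"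
      unfolding S_def using s(1,2,6)[OF z] s(4)[OF z, symmetric] by (rule | simp only: W_def r_def)+
    have e: "(1 - S) / (1 + S) * u'' (W z) +
       ((1 - S) * (1 + 3 * S) / 2 + c - (a + b + 1) * (1 - S\<^sup>2)) / S * u' (W z)
       - a * b * (1 + S)\<^sup>2 * u (W z) = 0"
      using u(4)[OF s(5)[OF z]] unfolding p_def q_def S(4) by (simp flip: S(5))
    \<comment> \<open>The transformed equation arises from the hypergeometric one by the chain rule; the factor
      (1 + S)^2 normalizes the coefficient of u'' to w.\<close>
    have "(1 + S)\<^sup>2 * (z * (1 - z) * f'' z + (c - (a + b + 1) * z) * f' z - a * b * f z) =
       (1 - S) / (1 + S) * u'' (W z) +
       ((1 - S) * (1 + 3 * S) / 2 + c - (a + b + 1) * (1 - S\<^sup>2)) / S * u' (W z)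
       - a * b * (1 + S)\<^sup>2 * u (W z)"
    proof -
      have e1: "(1 + S)\<^sup>2 * (z * (1 - z) * (1 / (S * (1 + S)\<^sup>2))\<^sup>2) = (1 - S) / (1 + S)"
      proof -
        have "z = (1 - S) * (1 + S)" "1 - z = S\<^sup>2"
          unfolding S(3) by (simp_all add: algebra_simps power2_eq_square)
        then show ?thesis using S(1,2) by (simp add: divide_simps) (simp add: power2_eq_square power4_eq_xxxx)
      qed
      have e2: "(1 + S)\<^sup>2 * (z * (1 - z) * ((1 + 3 * S) / (2 * S ^ 3 * (1 + S) ^ 3))
          + (c - (a + b + 1) * z) * (1 / (S * (1 + S)\<^sup>2))) =
          ((1 - S) * (1 + 3 * S) / 2 + c - (a + b + 1) * (1 - S\<^sup>2)) / S"
      proof -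
        have 1: "z * (1 - z) = (1 - S) * (1 + S) * S\<^sup>2"
          unfolding S(3) by (simp add: algebra_simps power2_eq_square)
        have "(1 + S)\<^sup>2 * (z * (1 - z) * ((1 + 3 * S) / (2 * S ^ 3 * (1 + S) ^ 3))) = (1 - S) * (1 + 3 * S) / 2 / S"
          unfolding 1 using S(1,2) by (simp add: divide_simps) (simp add: power2_eq_square power3_eq_cube)
        moreover have "(1 + S)\<^sup>2 * ((c - (a + b + 1) * z) * (1 / (S * (1 + S)\<^sup>2))) = (c - (a + b + 1) * z) / S"
          using S(1,2) by simp
        ultimately show ?thesis
          unfolding S(3) by (simp add: distrib_left add_divide_distrib diff_divide_distrib)
      qed
      show ?thesis
        unfolding f''_def f'_def f_def S_def[symmetric] e1[symmetric] e2[symmetric]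
        by (simp add: algebra_simps)
    qed
    then show ?thesis using e S(2) by simp
  qed
  have "deriv f z = f' z" if "z \<in> cut_plane" for z using d1[OF that] by (rule DERIV_imp_deriv)
  moreover have "deriv (deriv f) z = f'' z" if "z \<in> cut_plane" for z
    using d2[OF that] has_field_derivative_transform_within_open[OF d2[OF that] open_cut_plane that]
      calculation by (metis DERIV_imp_deriv)
  moreover have "z \<in> cut_plane" if "norm z < 1" for z using that by (auto simp: cut_plane_def)
  moreover have f0: "f 0 = 1" using u(1) by (simp add: f_def W_def r_def s_def)
  moreover have "f holomorphic_on cut_plane"
    using d1 open_cut_plane by (auto simp: holomorphic_on_open)
  ultimately have "is_hyp2F1 a b c f"
    using ode c by (intro is_hyp2F1_of_ode) auto
  then show ?thesis using that d1 d2 ode f0 by blast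
qed

section \<open>Differential equations of the Bessel and Jacobi functions\<close>

text \<open>
  As a function of \<open>y = x\<^sup>2\<close> the normalized Bessel function is an entire function whose coefficients
  satisfy the recurrence of \<open>y S'' + (\<alpha> + 1) S' + S / 4 = 0\<close>. This equation has constant \<open>p\<close> and \<open>q\<close>, so
  the Frobenius bound yields the infinite radius of convergence as well.
\<close>

lemma norm_bessel_entire:
  assumes al: "\<alpha> > - 1 / 2"
  obtains S S' S'' :: "complex \<Rightarrow> complex" where "S 0 = 1"
    "\<And>w. (S has_field_derivative S' w) (at w)"
    "\<And>w. (S' has_field_derivative S'' w) (at w)"
    "\<And>w. w * S'' w + of_real (\<alpha> + 1) * S' w + S w / 4 = 0"
    "\<And>x. of_real (norm_bessel \<alpha> x) = S (of_real (x\<^sup>2))"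
proof -
  define b where "b l = Gamma (\<alpha> + 1) * ((- 1) ^ l / (4 ^ l * (fact l * Gamma (real l + \<alpha> + 1))))" for l
  define B :: "complex fps" where "B = Abs_fps (\<lambda>l. of_real (b l))"
  have G: "Gamma (real l + \<alpha> + 1) > 0" for l
    using al by (intro Gamma_real_pos) linarith
  have rec: "real (Suc l) * (real l + (\<alpha> + 1)) * b (Suc l) + b l / 4 = 0" for l
  proof -
    have "real l + \<alpha> + 1 > 0" using al by linarith
    then have "Gamma (real (Suc l) + \<alpha> + 1) = (real l + \<alpha> + 1) * Gamma (real l + \<alpha> + 1)"
      using Gamma_plus1[of "real l + \<alpha> + 1"] by (auto simp: nonpos_Ints_def add_ac)
    then show ?thesis
      using G[of l] \<open>real l + \<alpha> + 1 > 0\<close>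
      unfolding b_def by (simp add: divide_simps del: of_nat_Suc)
  qed
  have ode: "fps_X * fps_deriv (fps_deriv B) + fps_const (of_real (\<alpha> + 1)) * fps_deriv B + fps_const (1/4) * B = 0"
  proof (rule fps_ext)
    fix n
    have "complex_of_real (real (Suc n) * (real n + (\<alpha> + 1)) * b (Suc n) + b n / 4) = 0"
      unfolding rec by simp
    then show "(fps_X * fps_deriv (fps_deriv B) + fps_const (of_real (\<alpha> + 1)) * fps_deriv B + fps_const (1/4) * B) $ n = 0 $ n"
      by (cases n) (auto simp: B_def algebra_simps)
  qed
  note ev = frobenius_eval[OF ode, of \<infinity>, simplified]
  have "of_real (norm_bessel \<alpha> x) = eval_fps B (of_real (x\<^sup>2))" for x
  proof -
    have "\<infinity> \<le> fps_conv_radius B" by (rule frobenius_conv_radius[OF ode]) auto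
    then have "(\<lambda>l. B $ l * of_real (x\<^sup>2) ^ l) sums eval_fps B (of_real (x\<^sup>2))"
      by (intro sums_eval_fps) auto
    moreover have "B $ l * of_real (x\<^sup>2) ^ l = complex_of_real (b l * (x\<^sup>2) ^ l)" for l
      by (simp add: B_def)
    ultimately have s: "(\<lambda>l. complex_of_real (b l * (x\<^sup>2) ^ l)) sums eval_fps B (of_real (x\<^sup>2))"
      by (simp only:)
    then have "summable (\<lambda>l. b l * (x\<^sup>2) ^ l)"
      using summable_of_real_iff sums_summable by blast
    then have 1: "eval_fps B (of_real (x\<^sup>2)) = of_real (\<Sum>l. b l * (x\<^sup>2) ^ l)"
      using s by (metis sums_of_real sums_unique2 summable_sums)
    define e where "e l = (- 1) ^ l * (x / 2) ^ (2 * l) / (fact l * Gamma (real l + \<alpha> + 1))" for l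
    have be: "b l * (x\<^sup>2) ^ l = Gamma (\<alpha> + 1) * e l" for l
      unfolding b_def e_def by (simp add: power_mult power_divide)
    have "Gamma (\<alpha> + 1) \<noteq> 0" using G[of 0] by simp
    then have "summable e"
      using \<open>summable (\<lambda>l. b l * (x\<^sup>2) ^ l)\<close> unfolding be by (simp add: summable_cmult_iff)
    then have "(\<Sum>l. b l * (x\<^sup>2) ^ l) = norm_bessel \<alpha> x"
      unfolding norm_bessel_def be e_def[symmetric] by (rule suminf_mult)
    then show ?thesis using 1 by simp
  qed
  moreover have "eval_fps B 0 = 1"
    using G[of 0] by (simp add: eval_fps_at_0 B_def b_def)
  ultimately show ?thesis
    using ev by (intro that[of "eval_fps B"]) (auto simp: algebra_simps)
qed

lemma chain_of_real:
  fixes f f' f'' :: "complex \<Rightarrow> complex" and h h' h'' :: "real \<Rightarrow> real"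
  assumes f: "(f has_field_derivative f' (of_real (h t))) (at (of_real (h t)))"
    and f': "(f' has_field_derivative f'' (of_real (h t))) (at (of_real (h t)))"
    and h: "(h has_real_derivative h' t) (at t)"
    and h': "(h' has_real_derivative h'' t) (at t)"
  shows "((\<lambda>t. f (of_real (h t))) has_vector_derivative of_real (h' t) * f' (of_real (h t))) (at t)"
    and "((\<lambda>t. of_real (h' t) * f' (of_real (h t))) has_vector_derivative
            of_real (h'' t) * f' (of_real (h t)) + (of_real (h' t))\<^sup>2 * f'' (of_real (h t))) (at t)"
proof -
  have d: "((\<lambda>t. complex_of_real (k t)) has_vector_derivative of_real D) (at t)"
    if "(k has_real_derivative D) (at t)" for k D
    using that by (intro has_vector_derivative_of_real) (simp add: has_real_derivative_iff_has_vector_derivative)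
  show "((\<lambda>t. f (of_real (h t))) has_vector_derivative of_real (h' t) * f' (of_real (h t))) (at t)"
    using field_vector_diff_chain_at[OF d[OF h] f] by (simp add: o_def)
  have "((\<lambda>t. f' (of_real (h t))) has_vector_derivative of_real (h' t) * f'' (of_real (h t))) (at t)"
    using field_vector_diff_chain_at[OF d[OF h] f'] by (simp add: o_def)
  from has_vector_derivative_mult[OF d[OF h'] this]
  show "((\<lambda>t. of_real (h' t) * f' (of_real (h t))) has_vector_derivative
            of_real (h'' t) * f' (of_real (h t)) + (of_real (h' t))\<^sup>2 * f'' (of_real (h t))) (at t)"
    by (simp add: algebra_simps power2_eq_square)
qed

text \<open>
  The equation is multiplied by \<open>t\<close>, so that it holds at \<open>t = 0\<close> and for negative \<open>t\<close> too; this
  permits the substitution of \<open>\<lambda>t\<close> for every real \<open>\<lambda>\<close>.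
\<close>

lemma norm_bessel_ode:
  assumes al: "\<alpha> > - 1 / 2"
  obtains j' j'' :: "real \<Rightarrow> complex" where "norm_bessel \<alpha> 0 = 1" "j' 0 = 0"
    "\<And>t. ((\<lambda>t. of_real (norm_bessel \<alpha> t)) has_vector_derivative j' t) (at t)"
    "\<And>t. (j' has_vector_derivative j'' t) (at t)"
    "\<And>t. of_real t * j'' t + of_real (2 * \<alpha> + 1) * j' t + of_real t * of_real (norm_bessel \<alpha> t) = 0"
proof -
  obtain S S' S'' :: "complex \<Rightarrow> complex" where S: "S 0 = 1"
    "\<And>w. (S has_field_derivative S' w) (at w)"
    "\<And>w. (S' has_field_derivative S'' w) (at w)"
    "\<And>w. w * S'' w + of_real (\<alpha> + 1) * S' w + S w / 4 = 0"
    "\<And>x. of_real (norm_bessel \<alpha> x) = S (of_real (x\<^sup>2))"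
    using norm_bessel_entire[OF al] by metis
  define h where "h t = t\<^sup>2" for t :: real
  have J: "(\<lambda>t. of_real (norm_bessel \<alpha> t)) = (\<lambda>t. S (of_real (h t)))"
    using S(5) by (simp add: fun_eq_iff h_def)
  note ch = chain_of_real[of S S' h _ S'' "\<lambda>t. 2 * t" "\<lambda>t. 2", OF S(2,3), folded J]
  have dh: "(h has_real_derivative 2 * t) (at t)" for t
    unfolding h_def by (auto intro!: derivative_eq_intros)
  have dh': "((\<lambda>t. 2 * t) has_real_derivative 2) (at t)" for t
    by (auto intro!: derivative_eq_intros)
  show ?thesis
  proof (rule that)
    have "complex_of_real (norm_bessel \<alpha> 0) = 1" using S(5)[of 0] S(1) by simp
    then show "norm_bessel \<alpha> 0 = 1" by simp
    show "((\<lambda>t. of_real (norm_bessel \<alpha> t)) has_vector_derivative of_real (2 * t) * S' (of_real (h t))) (at t)" for t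
      using ch(1)[OF dh dh'] .
    show "((\<lambda>t. of_real (2 * t) * S' (of_real (h t))) has_vector_derivative
            of_real 2 * S' (of_real (h t)) + (of_real (2 * t))\<^sup>2 * S'' (of_real (h t))) (at t)" for t
      using ch(2)[OF dh dh'] .
    show "of_real t * (of_real 2 * S' (of_real (h t)) + (of_real (2 * t))\<^sup>2 * S'' (of_real (h t)))
       + of_real (2 * \<alpha> + 1) * (of_real (2 * t) * S' (of_real (h t))) + of_real t * of_real (norm_bessel \<alpha> t) = 0" for t
    proof -
      have "of_real t * (of_real 2 * S' (of_real (h t)) + (of_real (2 * t))\<^sup>2 * S'' (of_real (h t)))
       + of_real (2 * \<alpha> + 1) * (of_real (2 * t) * S' (of_real (h t))) + of_real t * of_real (norm_bessel \<alpha> t)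
       = 4 * of_real t * (of_real (h t) * S'' (of_real (h t)) + of_real (\<alpha> + 1) * S' (of_real (h t)) + S (of_real (h t)) / 4)"
        unfolding S(5) by (simp add: h_def power2_eq_square algebra_simps)
      then show ?thesis unfolding S(4) by simp
    qed
  qed simp
qed

text \<open>
  The substitution \<open>z = - sinh\<^sup>2 t\<close> turns the hypergeometric equation into the radial eigenvalue
  equation of a Laplacian with weight \<open>sinh\<^bsup>2\<alpha>+1\<^esup> t cosh\<^bsup>2\<beta>+1\<^esup> t\<close>. It is used with the holomorphic
  continuation, so that no bound on \<open>t\<close> arises from the unit disc.
\<close>

lemma jacobi_fun_ode:
  assumes al: "\<alpha> > - 1 / 2"
  obtains \<phi>' \<phi>'' :: "real \<Rightarrow> complex" where "jacobi_fun \<alpha> \<beta> \<mu> 0 = 1" "\<phi>' 0 = 0"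
    "\<And>t. (jacobi_fun \<alpha> \<beta> \<mu> has_vector_derivative \<phi>' t) (at t)"
    "\<And>t. (\<phi>' has_vector_derivative \<phi>'' t) (at t)"
    "\<And>t. t > 0 \<Longrightarrow> \<phi>'' t + of_real ((2 * \<alpha> + 1) * (cosh t / sinh t) + (2 * \<beta> + 1) * (sinh t / cosh t)) * \<phi>' t
        + (\<mu>\<^sup>2 + of_real ((\<alpha> + \<beta> + 1)\<^sup>2)) * jacobi_fun \<alpha> \<beta> \<mu> t = 0"
proof -
  define a where "a = (of_real (\<alpha> + \<beta> + 1) - \<i> * \<mu>) / 2"
  define b where "b = (of_real (\<alpha> + \<beta> + 1) + \<i> * \<mu>) / 2"
  define c where "c = complex_of_real (\<alpha> + 1)"
  have "of_nat n + c \<noteq> 0" for n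
  proof -
    have "Re (of_nat n + c) > 0" using al unfolding c_def by simp
    then show ?thesis by (metis less_irrefl zero_complex.simps(1))
  qed
  then obtain f f' f'' where f: "is_hyp2F1 a b c f"
    "\<And>z. z \<in> cut_plane \<Longrightarrow> (f has_field_derivative f' z) (at z)"
    "\<And>z. z \<in> cut_plane \<Longrightarrow> (f' has_field_derivative f'' z) (at z)"
    "\<And>z. z \<in> cut_plane \<Longrightarrow>
      z * (1 - z) * f'' z + (c - (a + b + 1) * z) * f' z - a * b * f z = 0"
    "f 0 = 1"
    using hyp2F1_ode by metis
  define h where "h t = - (sinh t)\<^sup>2" for t :: real
  have cut: "complex_of_real (h t) \<in> cut_plane" for t
  proof -
    have "h t < 1" unfolding h_def by (simp add: less_le_trans[of _ 0])
    then show ?thesis by (auto simp: cut_plane_def)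
  qed
  have J: "jacobi_fun \<alpha> \<beta> \<mu> = (\<lambda>t. f (of_real (h t)))"
    using hyp2F1_eqI[OF f(1) cut] by (simp add: fun_eq_iff jacobi_fun_def h_def a_def b_def c_def)
  define h' where "h' t = - 2 * sinh t * cosh t" for t :: real
  define h'' where "h'' t = - 2 * ((cosh t)\<^sup>2 + (sinh t)\<^sup>2)" for t :: real
  have dh: "(h has_real_derivative h' t) (at t)" for t
    unfolding h_def h'_def by (auto intro!: derivative_eq_intros)
  have dh': "(h' has_real_derivative h'' t) (at t)" for t
    unfolding h'_def h''_def by (auto intro!: derivative_eq_intros simp: power2_eq_square algebra_simps)
  note ch = chain_of_real[of f f' h _ f'' h' h'', OF f(2)[OF cut] f(3)[OF cut] dh dh', folded J]
  show ?thesis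
  proof (rule that[OF _ _ ch])
    show "jacobi_fun \<alpha> \<beta> \<mu> 0 = 1" by (simp add: J h_def f(5))
    show "of_real (h' 0) * f' (of_real (h 0)) = 0" by (simp add: h'_def)
    fix t :: real assume t: "t > 0"
    define z where "z = complex_of_real (h t)"
    define s where "s = complex_of_real ((sinh t)\<^sup>2)"
    have zs: "z = - s" by (simp add: z_def s_def h_def)
    have s_pos: "sinh t > 0" "cosh t > 0" using t by auto
    have hs: "of_real (h'' t) = - 2 * (1 + 2 * s)" "(of_real (h' t))\<^sup>2 = 4 * s * (1 + s)"
    proof -
      have "h'' t = - 2 * (1 + 2 * (sinh t)\<^sup>2)" "(h' t)\<^sup>2 = 4 * (sinh t)\<^sup>2 * (1 + (sinh t)\<^sup>2)"
        by (simp_all add: h''_def h'_def cosh_square_eq power_mult_distrib algebra_simps)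
      then show "of_real (h'' t) = - 2 * (1 + 2 * s)" "(of_real (h' t))\<^sup>2 = 4 * s * (1 + s)"
        unfolding of_real_power[symmetric] by (simp_all add: s_def)
    qed
    have "((2 * \<alpha> + 1) * (cosh t / sinh t) + (2 * \<beta> + 1) * (sinh t / cosh t)) * h' t
        = - 2 * ((2 * \<alpha> + 1) * (cosh t)\<^sup>2 + (2 * \<beta> + 1) * (sinh t)\<^sup>2)"
      unfolding h'_def using s_pos by (simp add: field_simps power2_eq_square)
    also have "\<dots> = - 2 * ((2 * \<alpha> + 1) * (1 + (sinh t)\<^sup>2) + (2 * \<beta> + 1) * (sinh t)\<^sup>2)"
      by (simp add: cosh_square_eq add.commute)
    finally have A: "of_real ((2 * \<alpha> + 1) * (cosh t / sinh t) + (2 * \<beta> + 1) * (sinh t / cosh t)) * complex_of_real (h' t)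
       = - 2 * ((2 * of_real \<alpha> + 1) * (1 + s) + (2 * of_real \<beta> + 1) * s)"
      unfolding of_real_mult[symmetric] by (simp add: s_def)
    have ab: "a + b = of_real \<alpha> + of_real \<beta> + 1" "4 * (a * b) = \<mu>\<^sup>2 + of_real ((\<alpha> + \<beta> + 1)\<^sup>2)"
      by (simp_all add: a_def b_def field_simps power2_eq_square)
    have o: "- s * (1 + s) * f'' z = a * b * f z - (of_real \<alpha> + 1 + (of_real \<alpha> + of_real \<beta> + 2) * s) * f' z"
      using f(4)[OF cut[of t], folded z_def] unfolding ab(1) zs c_def by (simp add: algebra_simps)
    show "of_real (h'' t) * f' (of_real (h t)) + (of_real (h' t))\<^sup>2 * f'' (of_real (h t)) +
        of_real ((2 * \<alpha> + 1) * (cosh t / sinh t) + (2 * \<beta> + 1) * (sinh t / cosh t)) * (of_real (h' t) * f' (of_real (h t)))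
        + (\<mu>\<^sup>2 + of_real ((\<alpha> + \<beta> + 1)\<^sup>2)) * jacobi_fun \<alpha> \<beta> \<mu> t = 0"
      unfolding mult.assoc[symmetric] A J z_def[symmetric] hs ab(2)[symmetric]
      using o by (simp add: algebra_simps) algebra
  qed
qed

section \<open>Energy estimate for damped oscillators\<close>

text \<open>
  Let \<open>F = |y'|\<^sup>2 + \<omega>\<^sup>2|y|\<^sup>2\<close>. The terms with \<open>\<omega>\<close> cancel in \<open>F'\<close>, and the damping contributes
  \<open>- 2A|y'|\<^sup>2 \<le> 0\<close>; what is left is \<open>F' \<le> 2|y'||g| \<le> 2 sqrt F (\<kappa> sqrt F + K)\<close>, that is,
  \<open>(sqrt F)' \<le> \<kappa> sqrt F + K\<close>, and Gronwall's argument applies. The equation is needed only for \<open>t > 0\<close>,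
  so \<open>A\<close> may be singular at 0.
\<close>

lemma damped_oscillator_energy:
  fixes y y' y'' g :: "real \<Rightarrow> 'a :: real_inner" and A :: "real \<Rightarrow> real"
  assumes T: "0 \<le> T"
    and y: "\<And>t. (y has_vector_derivative y' t) (at t)"
    and y': "\<And>t. (y' has_vector_derivative y'' t) (at t)"
    and ode: "\<And>t. 0 < t \<Longrightarrow> t < T \<Longrightarrow> y'' t + A t *\<^sub>R y' t + \<omega>\<^sup>2 *\<^sub>R y t = g t"
    and A: "\<And>t. 0 < t \<Longrightarrow> t < T \<Longrightarrow> 0 \<le> A t"
    and g: "\<And>t. 0 < t \<Longrightarrow> t < T \<Longrightarrow>
              norm (g t) \<le> \<kappa> * sqrt ((norm (y' t))\<^sup>2 + \<omega>\<^sup>2 * (norm (y t))\<^sup>2) + K"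
    and \<kappa>: "0 \<le> \<kappa>" and K: "0 \<le> K"
  shows "sqrt ((norm (y' T))\<^sup>2 + \<omega>\<^sup>2 * (norm (y T))\<^sup>2)
       \<le> exp (\<kappa> * T) * (sqrt ((norm (y' 0))\<^sup>2 + \<omega>\<^sup>2 * (norm (y 0))\<^sup>2) + K * T)"
proof (rule field_le_epsilon)
  fix e :: real assume e: "e > 0"
  define \<epsilon> where "\<epsilon> = e / exp (\<kappa> * T)"
  have \<epsilon>: "\<epsilon> > 0" using e by (simp add: \<epsilon>_def)
  define F where "F t = (norm (y' t))\<^sup>2 + \<omega>\<^sup>2 * (norm (y t))\<^sup>2" for t
  have F0: "F t \<ge> 0" for t by (simp add: F_def)
  have F: "(F has_real_derivative 2 * (y' t \<bullet> y'' t) + 2 * \<omega>\<^sup>2 * (y t \<bullet> y' t)) (at t)" for t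
    unfolding F_def power2_norm_eq_inner has_field_derivative_def
    by (rule derivative_eq_intros y[unfolded has_vector_derivative_def] y'[unfolded has_vector_derivative_def] refl)+
       (auto simp: fun_eq_iff inner_commute algebra_simps)
  \<comment> \<open>sqrt F need not be differentiable where F = 0; adding the square of epsilon avoids
    the zeros, and the choice of epsilon turns the final error into e.\<close>
  define H where "H t = sqrt (F t + \<epsilon>\<^sup>2)" for t
  have H0: "H t > 0" and HF: "sqrt (F t) \<le> H t" for t
    using F0[of t] \<epsilon> by (auto simp: H_def add_nonneg_pos)
  define H' where "H' t = (y' t \<bullet> y'' t + \<omega>\<^sup>2 * (y t \<bullet> y' t)) / H t" for t
  have H: "(H has_real_derivative H' t) (at t)" for t
  proof -
    have "F t + \<epsilon>\<^sup>2 > 0" using F0[of t] \<epsilon> by (simp add: add_nonneg_pos)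
    then have "(sqrt has_real_derivative inverse (sqrt (F t + \<epsilon>\<^sup>2)) / 2) (at (F t + \<epsilon>\<^sup>2))"
      by (rule DERIV_real_sqrt)
    moreover have "((\<lambda>t. F t + \<epsilon>\<^sup>2) has_real_derivative
        2 * (y' t \<bullet> y'' t) + 2 * \<omega>\<^sup>2 * (y t \<bullet> y' t)) (at t)"
      using DERIV_add[OF F DERIV_const] by simp
    ultimately have "(H has_real_derivative inverse (sqrt (F t + \<epsilon>\<^sup>2)) / 2 *
        (2 * (y' t \<bullet> y'' t) + 2 * \<omega>\<^sup>2 * (y t \<bullet> y' t))) (at t)"
      unfolding H_def by (rule DERIV_chain2)
    moreover have "inverse (sqrt (F t + \<epsilon>\<^sup>2)) / 2 * (2 * (y' t \<bullet> y'' t) + 2 * \<omega>\<^sup>2 * (y t \<bullet> y' t)) = H' t"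
      unfolding H'_def H_def divide_inverse by algebra
    ultimately show ?thesis by (simp only:)
  qed
  have H_le: "H' t \<le> \<kappa> * H t + K"
    if t: "0 < t" "t < T" for t
  proof -
    have "y'' t = g t - A t *\<^sub>R y' t - \<omega>\<^sup>2 *\<^sub>R y t" using ode[OF t] by (simp add: algebra_simps)
    then have "y' t \<bullet> y'' t + \<omega>\<^sup>2 * (y t \<bullet> y' t) = y' t \<bullet> g t - A t * (y' t \<bullet> y' t)"
      by (simp add: inner_diff_right inner_commute)
    also have "\<dots> \<le> y' t \<bullet> g t" using A[OF t] by simp
    also have "\<dots> \<le> norm (y' t) * norm (g t)" by (rule norm_cauchy_schwarz)
    also have "\<dots> \<le> H t * (\<kappa> * H t + K)"
    proof (rule mult_mono)
      have "norm (y' t) \<le> sqrt (F t)" by (rule real_le_rsqrt) (simp add: F_def)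
      then show "norm (y' t) \<le> H t" using HF[of t] by linarith
      have "\<kappa> * sqrt (F t) \<le> \<kappa> * H t" using HF[of t] \<kappa> by (rule mult_left_mono)
      then show "norm (g t) \<le> \<kappa> * H t + K" using g[OF t] unfolding F_def by linarith
    qed (use H0[of t] in auto)
    finally show ?thesis unfolding H'_def using H0[of t] by (simp add: pos_divide_le_eq mult.commute)
  qed
  define G where "G t = H t * exp (- (\<kappa> * t)) - K * t" for t
  have "G T \<le> G 0"
  proof (rule DERIV_nonpos_imp_decreasing_open[OF T])
    fix t assume t: "0 < t" "t < T"
    have G: "(G has_real_derivative (H' t - \<kappa> * H t) * exp (- (\<kappa> * t)) - K) (at t)"
      unfolding G_def by (auto intro!: derivative_eq_intros H simp: algebra_simps)
    have "(H' t - \<kappa> * H t) * exp (- (\<kappa> * t)) \<le> K * exp (- (\<kappa> * t))"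
      using H_le[OF t] by (intro mult_right_mono) auto
    also have "\<dots> \<le> K * 1"
      using K \<kappa> t by (intro mult_left_mono) auto
    finally show "\<exists>D. (G has_real_derivative D) (at t) \<and> D \<le> 0"
      using G by (intro exI[of _ "(H' t - \<kappa> * H t) * exp (- (\<kappa> * t)) - K"]) simp
  next
    have "continuous_on {0..T} H"
      using DERIV_isCont[OF H] by (simp add: continuous_at_imp_continuous_on)
    then show "continuous_on {0..T} G" unfolding G_def by (intro continuous_intros)
  qed
  moreover have "H 0 \<le> sqrt (F 0) + \<epsilon>"
    unfolding H_def using sqrt_add_le_add_sqrt[of "F 0" "\<epsilon>\<^sup>2"] F0[of 0] \<epsilon> by simp
  ultimately have "H T * exp (- (\<kappa> * T)) \<le> sqrt (F 0) + \<epsilon> + K * T" by (simp add: G_def)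
  then have "exp (\<kappa> * T) * (H T * exp (- (\<kappa> * T))) \<le> exp (\<kappa> * T) * (sqrt (F 0) + \<epsilon> + K * T)"
    by simp
  moreover have "exp (\<kappa> * T) * (H T * exp (- (\<kappa> * T))) = H T" by (simp add: exp_minus)
  moreover have "exp (\<kappa> * T) * (sqrt (F 0) + \<epsilon> + K * T) = exp (\<kappa> * T) * (sqrt (F 0) + K * T) + e"
    by (simp add: \<epsilon>_def distrib_left)
  ultimately have "H T \<le> exp (\<kappa> * T) * (sqrt (F 0) + K * T) + e" by linarith
  then show "sqrt ((norm (y' T))\<^sup>2 + \<omega>\<^sup>2 * (norm (y T))\<^sup>2)
       \<le> exp (\<kappa> * T) * (sqrt ((norm (y' 0))\<^sup>2 + \<omega>\<^sup>2 * (norm (y 0))\<^sup>2) + K * T) + e"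
    using HF[of T] by (simp add: F_def)
qed

section \<open>Comparison of Jacobi and Bessel functions\<close>

text \<open>
  The upper bound amounts to \<open>x exp(-x) \<le> sinh x\<close>, that is, to \<open>1 + 2x \<le> exp(2x)\<close>.
\<close>

lemma coth_bounds:
  fixes x :: real
  assumes "x > 0"
  shows "1 / x \<le> cosh x / sinh x" "cosh x / sinh x \<le> 1 / x + 1"
proof -
  have sinh: "sinh x > 0" using assms by simp
  have "(sinh x - x * cosh x) \<le> (sinh 0 - 0 * cosh (0::real))"
  proof (rule DERIV_nonpos_imp_nonincreasing[of 0 x "\<lambda>x. sinh x - x * cosh x"])
    fix y :: real assume "0 \<le> y" "y \<le> x"
    then show "\<exists>d. ((\<lambda>x. sinh x - x * cosh x) has_real_derivative d) (at y) \<and> d \<le> 0"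
      by (intro exI[of _ "- (y * sinh y)"]) (auto intro!: derivative_eq_intros)
  qed (use assms in simp)
  then show "1 / x \<le> cosh x / sinh x" using assms sinh by (simp add: field_simps)
  have "x * exp (- x) \<le> sinh x"
  proof -
    have "2 * x + 1 \<le> exp (2 * x)" using exp_ge_add_one_self[of "2 * x"] by linarith
    then have "2 * x * exp (- x) \<le> (exp (2 * x) - 1) * exp (- x)"
      by (intro mult_right_mono) auto
    also have "\<dots> = 2 * sinh x"
      by (simp add: sinh_field_def left_diff_distrib flip: exp_add)
    finally show ?thesis by simp
  qed
  moreover have "x * exp (- x) = x * cosh x - x * sinh x"
    by (simp add: cosh_minus_sinh flip: right_diff_distrib)
  ultimately show "cosh x / sinh x \<le> 1 / x + 1"
    using assms sinh by (simp add: field_simps)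
qed

theorem proposition2p4:
  fixes \<alpha> \<beta> \<rho> T :: real
  assumes "\<alpha> \<ge> \<beta>" and "\<beta> \<ge> - 1 / 2" and "\<alpha> > - 1 / 2"
    and "\<rho> = \<alpha> + \<beta> + 1"
    and "T > 0"
  shows "\<exists>C::real. \<forall>(lam::real) (t::real) (n::nat). t \<in> {0..T} \<longrightarrow> n \<ge> 1 \<longrightarrow>
    norm (jacobi_fun \<alpha> \<beta> (\<i> * of_real \<rho> - of_nat n * of_real lam) (t / real n)
            - of_real (norm_bessel \<alpha> (lam * t)))
      \<le> C * \<bar>lam\<bar> * t\<^sup>2 / real n"
proof (intro exI allI impI)
  fix lam t :: real and n :: nat
  assume t: "t \<in> {0..T}" and n: "n \<ge> 1"
  define \<mu> where "\<mu> = \<i> * of_real \<rho> - of_nat n * of_real lam"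
  define m where "m = real n"
  have m: "m \<ge> 1" using n by (simp add: m_def)
  have rho: "\<rho> > 0" using assms by linarith
  obtain \<phi>' \<phi>'' :: "real \<Rightarrow> complex" where \<phi>: "jacobi_fun \<alpha> \<beta> \<mu> 0 = 1" "\<phi>' 0 = 0"
    "\<And>t. (jacobi_fun \<alpha> \<beta> \<mu> has_vector_derivative \<phi>' t) (at t)"
    "\<And>t. (\<phi>' has_vector_derivative \<phi>'' t) (at t)"
    "\<And>t. t > 0 \<Longrightarrow> \<phi>'' t + of_real ((2 * \<alpha> + 1) * (cosh t / sinh t) + (2 * \<beta> + 1) * (sinh t / cosh t)) * \<phi>' t
        + (\<mu>\<^sup>2 + of_real ((\<alpha> + \<beta> + 1)\<^sup>2)) * jacobi_fun \<alpha> \<beta> \<mu> t = 0"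
    using jacobi_fun_ode[OF assms(3)] by metis
  obtain j' j'' :: "real \<Rightarrow> complex" where j: "norm_bessel \<alpha> 0 = 1" "j' 0 = 0"
    "\<And>t. ((\<lambda>t. of_real (norm_bessel \<alpha> t)) has_vector_derivative j' t) (at t)"
    "\<And>t. (j' has_vector_derivative j'' t) (at t)"
    "\<And>t. of_real t * j'' t + of_real (2 * \<alpha> + 1) * j' t + of_real t * of_real (norm_bessel \<alpha> t) = 0"
    using norm_bessel_ode[OF assms(3)] by metis
  have rescale: "((\<lambda>t. f (k * t)) has_vector_derivative k *\<^sub>R f' (k * s)) (at s)"
    if "\<And>t. (f has_vector_derivative f' t) (at t)" for f f' :: "real \<Rightarrow> complex" and k s
  proof -
    have "((\<lambda>t. k * t) has_vector_derivative k) (at s)"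
      by (auto intro!: derivative_eq_intros)
    from vector_diff_chain_at[OF this that] show ?thesis by (simp add: o_def)
  qed
  define v where "v s = jacobi_fun \<alpha> \<beta> \<mu> (1 / m * s)" for s
  define v' where "v' s = (1 / m) *\<^sub>R \<phi>' (1 / m * s)" for s
  define v'' where "v'' s = (1 / m) *\<^sub>R (1 / m) *\<^sub>R \<phi>'' (1 / m * s)" for s
  define w where "w s = complex_of_real (norm_bessel \<alpha> (lam * s))" for s
  define w' where "w' s = lam *\<^sub>R j' (lam * s)" for s
  define w'' where "w'' s = lam *\<^sub>R lam *\<^sub>R j'' (lam * s)" for s
  define A where "A s = (1 / m) * ((2 * \<alpha> + 1) * (cosh (1 / m * s) / sinh (1 / m * s))
      + (2 * \<beta> + 1) * (sinh (1 / m * s) / cosh (1 / m * s)))" for s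
  define A0 where "A0 s = (2 * \<alpha> + 1) / s" for s
  define \<kappa> where "\<kappa> = 2 * \<rho> / m"
  have \<kappa>: "0 \<le> \<kappa>" using rho m by (simp add: \<kappa>_def)
  have dv: "(v has_vector_derivative v' s) (at s)" "(v' has_vector_derivative v'' s) (at s)" for s
    unfolding v_def v'_def v''_def
    using rescale[OF \<phi>(3)] bounded_linear.has_vector_derivative[OF bounded_linear_scaleR_right rescale[OF \<phi>(4)]]
    by blast+
  have dw: "(w has_vector_derivative w' s) (at s)" "(w' has_vector_derivative w'' s) (at s)" for s
    unfolding w_def w'_def w''_def
    using rescale[OF j(3)] bounded_linear.has_vector_derivative[OF bounded_linear_scaleR_right rescale[OF j(4)]]
    by blast+
  have v0: "v 0 = 1" "v' 0 = 0" and w0: "w 0 = 1" "w' 0 = 0"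
    using \<phi>(1,2) j(1,2) by (simp_all add: v_def v'_def w_def w'_def)
  have v_ode: "v'' s + A s *\<^sub>R v' s + lam\<^sup>2 *\<^sub>R v s = (\<i> * of_real (\<kappa> * lam)) * v s" if s: "s > 0" for s
  proof -
    have mu: "(of_real (1 / m))\<^sup>2 * (\<mu>\<^sup>2 + of_real ((\<alpha> + \<beta> + 1)\<^sup>2)) = of_real (lam\<^sup>2) - \<i> * of_real (\<kappa> * lam)"
    proof -
      have mu_eq: "\<mu> = \<i> * of_real \<rho> - of_real m * of_real lam" by (simp add: \<mu>_def m_def)
      have "\<mu>\<^sup>2 + of_real ((\<alpha> + \<beta> + 1)\<^sup>2) = (of_real m)\<^sup>2 * of_real (lam\<^sup>2) - 2 * \<i> * of_real (\<rho> * m * lam)"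
        unfolding assms(4)[symmetric] mu_eq by (simp add: power2_eq_square algebra_simps)
      moreover have "complex_of_real m \<noteq> 0" using m by simp
      ultimately show ?thesis
        by (simp add: \<kappa>_def power_divide right_diff_distrib) (simp add: power2_eq_square)
    qed
    have "1 / m * s > 0" using s m by simp
    from arg_cong[OF \<phi>(5)[OF this], of "\<lambda>z. (of_real (1 / m))\<^sup>2 * z"]
    have "(of_real (1 / m))\<^sup>2 * \<phi>'' (1 / m * s) + of_real (1 / m) * of_real (A s) * \<phi>' (1 / m * s)
        + (of_real (1 / m))\<^sup>2 * (\<mu>\<^sup>2 + of_real ((\<alpha> + \<beta> + 1)\<^sup>2)) * v s = 0"
      by (simp add: A_def v_def algebra_simps power2_eq_square)
    then show ?thesis unfolding mu
      by (simp add: v'_def v''_def scaleR_conv_of_real algebra_simps power2_eq_square)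
  qed
  have w_ode: "w'' s + A0 s *\<^sub>R w' s + lam\<^sup>2 *\<^sub>R w s = 0" if s: "s > 0" for s
  proof -
    \<comment> \<open>Multiplying by s matches the Bessel equation at lam * s without a case distinction on lam = 0.\<close>
    have "of_real s * (w'' s + A0 s *\<^sub>R w' s + lam\<^sup>2 *\<^sub>R w s)
      = of_real lam * (of_real (lam * s) * j'' (lam * s) + of_real (2 * \<alpha> + 1) * j' (lam * s)
          + of_real (lam * s) * of_real (norm_bessel \<alpha> (lam * s)))"
      using s by (simp add: w_def w'_def w''_def A0_def scaleR_conv_of_real field_simps power2_eq_square)
    then show ?thesis using s unfolding j(5) by simp
  qed
  have A0: "0 \<le> A0 s" and A_A0: "0 \<le> A s - A0 s" "A s - A0 s \<le> \<kappa>" if s: "s > 0" for s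
  proof -
    show "0 \<le> A0 s" using s assms by (simp add: A0_def)
    define x where "x = 1 / m * s"
    have x: "x > 0" using s m by (simp add: x_def)
    have "A0 s = (1 / m) * ((2 * \<alpha> + 1) * (1 / x))"
      using m s by (simp add: A0_def x_def)
    then have eq: "A s - A0 s = (1 / m) * ((2 * \<alpha> + 1) * (cosh x / sinh x - 1 / x) + (2 * \<beta> + 1) * (sinh x / cosh x))"
      by (simp add: A_def x_def algebra_simps)
    have c: "0 \<le> cosh x / sinh x - 1 / x" "cosh x / sinh x - 1 / x \<le> 1"
      using coth_bounds[OF x] by auto
    have h: "0 \<le> sinh x / cosh x" "sinh x / cosh x \<le> 1"
      using x sinh_less_cosh_real[of x] by auto
    have ab: "0 \<le> 2 * \<alpha> + 1" "0 \<le> 2 * \<beta> + 1" using assms by auto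
    show "0 \<le> A s - A0 s" unfolding eq
      using m by (intro mult_nonneg_nonneg add_nonneg_nonneg c h ab) auto
    have "(2 * \<alpha> + 1) * (cosh x / sinh x - 1 / x) + (2 * \<beta> + 1) * (sinh x / cosh x)
        \<le> (2 * \<alpha> + 1) * 1 + (2 * \<beta> + 1) * 1"
      by (intro add_mono mult_left_mono c h ab)
    also have "\<dots> = 2 * \<rho>" using assms(4) by simp
    finally show "A s - A0 s \<le> \<kappa>" unfolding eq \<kappa>_def using m
      by (simp add: divide_right_mono)
  qed
  have t0: "0 \<le> t" "t \<le> T" using t by auto
  define M where "M = \<bar>lam\<bar> * exp (2 * \<rho> * T)"
  \<comment> \<open>The energy of v starts at lam^2, and its forcing is at most kappa times the square root of
    the energy.\<close>
  have energy_v: "sqrt ((norm (v' s))\<^sup>2 + lam\<^sup>2 * (norm (v s))\<^sup>2) \<le> M" if s: "0 \<le> s" "s \<le> t" for s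
  proof -
    have "sqrt ((norm (v' s))\<^sup>2 + lam\<^sup>2 * (norm (v s))\<^sup>2)
        \<le> exp (\<kappa> * s) * (sqrt ((norm (v' 0))\<^sup>2 + lam\<^sup>2 * (norm (v 0))\<^sup>2) + 0 * s)"
    proof (rule damped_oscillator_energy[where y'' = v'' and A = A and g = "\<lambda>s. (\<i> * of_real (\<kappa> * lam)) * v s"])
      fix r :: real assume r: "0 < r"
      show "v'' r + A r *\<^sub>R v' r + lam\<^sup>2 *\<^sub>R v r = (\<i> * of_real (\<kappa> * lam)) * v r" using v_ode[OF r] .
      show "0 \<le> A r" using A0[OF r] A_A0(1)[OF r] by linarith
      have "\<bar>lam\<bar> * norm (v r) \<le> sqrt ((norm (v' r))\<^sup>2 + lam\<^sup>2 * (norm (v r))\<^sup>2)"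
        by (rule real_le_rsqrt) (simp add: power_mult_distrib)
      then show "norm (\<i> * of_real (\<kappa> * lam) * v r) \<le> \<kappa> * sqrt ((norm (v' r))\<^sup>2 + lam\<^sup>2 * (norm (v r))\<^sup>2) + 0"
        using \<kappa> mult_left_mono by (fastforce simp: norm_mult abs_mult mult.assoc)
    qed (use s dv \<kappa> in auto)
    also have "\<dots> = exp (\<kappa> * s) * \<bar>lam\<bar>" by (simp add: v0)
    also have "\<dots> \<le> M"
    proof -
      have "\<kappa> \<le> 2 * \<rho>" using rho m by (simp add: \<kappa>_def divide_le_eq mult_le_cancel_left1)
      then have "\<kappa> * s \<le> 2 * \<rho> * T" using s t0 \<kappa> rho by (intro mult_mono) auto
      then show ?thesis unfolding M_def by (simp add: mult.commute mult_left_mono)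
    qed
    finally show ?thesis .
  qed
  define K where "K = 2 * \<kappa> * M"
  have M: "0 \<le> M" by (simp add: M_def)
  have K: "0 \<le> K" using M \<kappa> by (simp add: K_def)
  \<comment> \<open>The difference starts with energy 0; its forcing consists of the right-hand side of the
    equation for v and of the error A - A0 in the damping, each at most kappa * M.\<close>
  have v_w': "norm (v' s - w' s) \<le> K * t" if s: "0 \<le> s" "s \<le> t" for s
  proof -
    have "norm (v' s - w' s) \<le> sqrt ((norm (v' s - w' s))\<^sup>2 + lam\<^sup>2 * (norm (v s - w s))\<^sup>2)"
      by (rule real_le_rsqrt) simp
    also have "\<dots> \<le> exp (0 * s) * (sqrt ((norm (v' 0 - w' 0))\<^sup>2 + lam\<^sup>2 * (norm (v 0 - w 0))\<^sup>2) + K * s)"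
    proof (rule damped_oscillator_energy[where y'' = "\<lambda>s. v'' s - w'' s" and A = A0
          and g = "\<lambda>s. (\<i> * of_real (\<kappa> * lam)) * v s - (A s - A0 s) *\<^sub>R v' s"])
      fix r :: real assume r: "0 < r" "r < s"
      show "v'' r - w'' r + A0 r *\<^sub>R (v' r - w' r) + lam\<^sup>2 *\<^sub>R (v r - w r) =
          (\<i> * of_real (\<kappa> * lam)) * v r - (A r - A0 r) *\<^sub>R v' r"
        unfolding v_ode[OF r(1), symmetric] using w_ode[OF r(1)] by (simp add: algebra_simps)
      show "0 \<le> A0 r" using A0[OF r(1)] .
      have e: "sqrt ((norm (v' r))\<^sup>2 + lam\<^sup>2 * (norm (v r))\<^sup>2) \<le> M"
        using energy_v[of r] r s by simp
      have "\<bar>lam\<bar> * norm (v r) \<le> sqrt ((norm (v' r))\<^sup>2 + lam\<^sup>2 * (norm (v r))\<^sup>2)"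
        "norm (v' r) \<le> sqrt ((norm (v' r))\<^sup>2 + lam\<^sup>2 * (norm (v r))\<^sup>2)"
        by (rule real_le_rsqrt, simp add: power_mult_distrib)+
      with e have b: "\<bar>lam\<bar> * norm (v r) \<le> M" "norm (v' r) \<le> M" by linarith+
      have "norm (\<i> * of_real (\<kappa> * lam) * v r) \<le> \<kappa> * M"
        using mult_left_mono[OF b(1) \<kappa>] \<kappa> by (simp add: norm_mult abs_mult mult.assoc)
      moreover have "norm ((A r - A0 r) *\<^sub>R v' r) \<le> \<kappa> * M"
        using A_A0[OF r(1)] b(2) \<kappa> by (simp add: mult_mono)
      ultimately show "norm (\<i> * of_real (\<kappa> * lam) * v r - (A r - A0 r) *\<^sub>R v' r)
          \<le> 0 * sqrt ((norm (v' r - w' r))\<^sup>2 + lam\<^sup>2 * (norm (v r - w r))\<^sup>2) + K"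
        unfolding K_def using norm_triangle_ineq4[of "\<i> * of_real (\<kappa> * lam) * v r" "(A r - A0 r) *\<^sub>R v' r"]
        by linarith
    qed (use s K dv dw in \<open>auto intro!: has_vector_derivative_diff\<close>)
    also have "\<dots> = K * s" by (simp add: v0 w0)
    also have "\<dots> \<le> K * t" using s K by (intro mult_left_mono) auto
    finally show ?thesis .
  qed
  have "norm ((v t - w t) - (v 0 - w 0)) \<le> K * t * norm (t - 0)"
  proof (rule differentiable_bound)
    show "convex {0..t}" by simp
    show "((\<lambda>s. v s - w s) has_derivative (\<lambda>h. h *\<^sub>R (v' s - w' s))) (at s within {0..t})" for s
      using has_vector_derivative_diff[OF dv(1)[of s] dw(1)[of s]]
      unfolding has_vector_derivative_def by (rule has_derivative_at_withinI)
    show "onorm (\<lambda>h. h *\<^sub>R (v' s - w' s)) \<le> K * t" if "s \<in> {0..t}" for s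
      using v_w'[of s] that by (intro onorm_le) (auto simp: mult.commute mult_left_mono)
  qed (use t0 in auto)
  then have "norm (v t - w t) \<le> K * t\<^sup>2"
    using t0 by (simp add: v0 w0 power2_eq_square mult.assoc)
  also have "K * t\<^sup>2 = (4 * \<rho> * exp (2 * \<rho> * T)) * \<bar>lam\<bar> * t\<^sup>2 / real n"
    by (simp add: K_def M_def \<kappa>_def m_def)
  finally show "norm (jacobi_fun \<alpha> \<beta> (\<i> * of_real \<rho> - of_nat n * of_real lam) (t / real n)
            - of_real (norm_bessel \<alpha> (lam * t)))
      \<le> (4 * \<rho> * exp (2 * \<rho> * T)) * \<bar>lam\<bar> * t\<^sup>2 / real n"
    by (simp add: v_def w_def m_def \<mu>_def)
qed

end
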